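(* Let $k$ and $N$ be positive integers such that $kN$ is a Vuza order. If the pair $(S,R)$ is a Vuza canon of $\mathbb{Z}_N$, then the pair $(S',R')$ with $$S'=kS\oplus\mathbb{I}_k,\qquad R'=kR$$ is a Vuza canon of $\mathbb{Z}_{kN}$.
   Context: $\mathbb{Z}_b=\{0,1,\dots,b-1\}$ denotes the cyclic group of order $b$ (addition modulo $b$). $\mathbb{I}_k=\{0,1,\dots,k-1\}\subseteq\mathbb{Z}_{kN}$, and for $T\subseteq\mathbb{Z}_N=\{0,\dots,N-1\}$, $kT=\{kt:t\in T\}\subseteq\mathbb{Z}_{kN}$. For non-empty subsets $S,R$ of a finite cyclic group $G$, the sum $S+R=\{s+r:s\in S,r\in R\}$ is direct, written $S\oplus R$, if every element of it is uniquely of the form $s+r$ with $s\in S$, $r\in R$. A non-empty subset $T$ of $G$ is periodic if there is $g\in G$, $g\neq 0$, with $T+g=T$. A Vuza canon of $G$ is a pair $(S,R)$ of non-empty subsets of $G$ such that $G=S\oplus R$ and neither $S$ nor $R$ is periodic. A Vuza order is an integer of the form $n_1n_2n_3p_1p_2$ with $n_1,n_2,n_3$ positive integers, $p_1,p_2$ different primes, $p_in_i\geq 2$ for $i=1,2$, and $n_1p_1$ coprime with $n_2p_2$.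
   Formalization: The case N = 1 is excluded: there ({0},{0}) is a Vuza canon of the trivial group by the literal definition, but S' is then all of Z_k with k ≥ 6, which is periodic, so the claim fails for N = 1. *)

theory Defs
  imports "HOL-Algebra.Elementary_Groups" "HOL-Computational_Algebra.Primes"
begin

definition direct_set_sum :: "('a, 'b) monoid_scheme \<Rightarrow> 'a set \<Rightarrow> 'a set \<Rightarrow> bool" where
  "direct_set_sum G S R \<longleftrightarrow>
     S \<subseteq> carrier G \<and> S \<noteq> {} \<and> R \<subseteq> carrier G \<and> R \<noteq> {} \<and>
     (\<forall>x \<in> S <#>\<^bsub>G\<^esub> R. \<exists>!p. p \<in> S \<times> R \<and> x = fst p \<otimes>\<^bsub>G\<^esub> snd p)"

definition periodic_set :: "('a, 'b) monoid_scheme \<Rightarrow> 'a set \<Rightarrow> bool" where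
  "periodic_set G T \<longleftrightarrow>
     T \<subseteq> carrier G \<and> T \<noteq> {} \<and> (\<exists>g \<in> carrier G. g \<noteq> \<one>\<^bsub>G\<^esub> \<and> T #>\<^bsub>G\<^esub> g = T)"

definition vuza_canon :: "('a, 'b) monoid_scheme \<Rightarrow> 'a set \<Rightarrow> 'a set \<Rightarrow> bool" where
  "vuza_canon G S R \<longleftrightarrow>
     direct_set_sum G S R \<and> carrier G = S <#>\<^bsub>G\<^esub> R \<and>
     \<not> periodic_set G S \<and> \<not> periodic_set G R"

definition vuza_order :: "nat \<Rightarrow> bool" where
  "vuza_order n \<longleftrightarrow>
     (\<exists>n1 n2 n3 p1 p2. n = n1 * n2 * n3 * p1 * p2 \<and>
        n1 > 0 \<and> n2 > 0 \<and> n3 > 0 \<and>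
        prime p1 \<and> prime p2 \<and> p1 \<noteq> p2 \<and>
        p1 * n1 \<ge> 2 \<and> p2 * n2 \<ge> 2 \<and>
        coprime (n1 * p1) (n2 * p2))"

end

theory Submission
  imports Defs
begin

text \<open>Write every element of \<open>{0..<k * N}\<close> as \<open>k * a + i\<close> with block number \<open>a < N\<close> and
  offset \<open>i < k\<close>. The set \<open>S'\<close> consists of the full blocks numbered by \<open>S\<close>, and adding an
  element \<open>k * r\<close> of \<open>R'\<close> translates block numbers by \<open>r\<close> modulo \<open>N\<close> and keeps
  the offset. A decomposition of \<open>k * a + i\<close> along \<open>S'\<close> and \<open>R'\<close> is therefore the same thing
  as a decomposition of \<open>a\<close> along \<open>S\<close> and \<open>R\<close>.

  For aperiodicity, a period of \<open>R'\<close> is a difference of elements of \<open>R'\<close>, hence a multiple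
  \<open>k * h\<close>, and \<open>h\<close> is a period of \<open>R\<close>. Let now \<open>g = k * h + j\<close> be a period of \<open>S'\<close>. The first
  element of each block shows that \<open>S + h \<subseteq> S\<close>. If \<open>h = 0\<close>, then \<open>j > 0\<close>, and the last
  element of each block spills over into the next one, so \<open>S + 1 \<subseteq> S\<close>. In both cases \<open>S\<close> is
  mapped into itself by a nonzero translation, where \<open>1 \<noteq> 0\<close> because \<open>N \<noteq> 1\<close>; finiteness then
  makes \<open>S\<close> periodic.\<close>

section \<open>Block decomposition of residues\<close>

text \<open>Reduction modulo \<open>k * N\<close> acts only on the block number. This is what transfers sums in
  \<open>\<int>/kN\<close> to sums of block numbers in \<open>\<int>/N\<close>.\<close>

lemma mod_block:
  fixes k a i N :: int
  assumes "0 \<le> i" "i < k" "N \<ge> 0"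
  shows "(k * a + i) mod (k * N) = k * (a mod N) + i"
  using assms by (simp add: zmod_zmult2_eq)

lemma block_eq_iff:
  fixes k a b i j :: int
  assumes "0 \<le> i" "i < k" "0 \<le> j" "j < k"
  shows "k * a + i = k * b + j \<longleftrightarrow> a = b \<and> i = j"
proof
  assume eq: "k * a + i = k * b + j"
  have "(k * a + i) div k = a" "(k * b + j) div k = b"
    using assms by simp_all
  with eq have "a = b" by simp
  with eq show "a = b \<and> i = j" by simp
qed simp

lemma block_bounds:
  fixes k N s i :: int
  assumes "0 \<le> s" "s < N" "0 \<le> i" "i < k"
  shows "0 \<le> k * s + i" "k * s + i < k * N"
proof -
  have "k * (s + 1) \<le> k * N"
    using assms by (intro mult_left_mono) auto
  then show "k * s + i < k * N"
    using assms by (simp add: algebra_simps)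
qed (use assms in simp)

lemma block_number_bounds:
  fixes k N x :: int
  assumes "k > 0" "0 \<le> x" "x < k * N"
  shows "0 \<le> x div k" "x div k < N"
proof -
  have "k * (x div k) \<le> x"
    using assms(1) mult_div_mod_eq[of k x] pos_mod_sign[of k x] by linarith
  also note \<open>x < k * N\<close>
  finally show "x div k < N" using assms(1) by simp
qed (use assms in \<open>simp add: pos_imp_zdiv_nonneg_iff\<close>)

section \<open>Direct sums and periods in terms of integers\<close>

lemma carrier_integer_mod_group_pos:
  "n > 0 \<Longrightarrow> carrier (integer_mod_group n) = {0..<int n}"
  by (simp add: carrier_integer_mod_group)

lemma r_coset_integer_mod_group:
  "T #>\<^bsub>integer_mod_group n\<^esub> g = (\<lambda>t. (t + g) mod int n) ` T"
  by (auto simp: r_coset_def mult_integer_mod_group)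

lemma set_mult_integer_mod_group:
  "S <#>\<^bsub>integer_mod_group n\<^esub> R = {(s + r) mod int n | s r. s \<in> S \<and> r \<in> R}"
  by (auto simp: set_mult_def mult_integer_mod_group)

lemma periodic_setE:
  assumes "periodic_set (integer_mod_group n) T" "n > 0"
  obtains g where "0 < g" "g < int n" "\<And>t. t \<in> T \<Longrightarrow> (t + g) mod int n \<in> T"
proof -
  have "\<exists>g \<in> {0..<int n}. g \<noteq> 0 \<and> (\<lambda>t. (t + g) mod int n) ` T = T"
    using assms
    by (simp add: periodic_set_def carrier_integer_mod_group_pos r_coset_integer_mod_group)
  then obtain g where "g \<in> {0..<int n}" "g \<noteq> 0" "(\<lambda>t. (t + g) mod int n) ` T = T"
    by blast
  then show thesis
    by (intro that[of g]) auto
qed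

text \<open>Over a finite group, a translation that maps a set into itself already permutes it, so
  periodicity can be established from a single inclusion.\<close>

lemma periodic_set_if_translate_subset:
  assumes "n > 0" "T \<subseteq> {0..<int n}" "T \<noteq> {}" "0 < g" "g < int n"
    and sub: "\<And>t. t \<in> T \<Longrightarrow> (t + g) mod int n \<in> T"
  shows "periodic_set (integer_mod_group n) T"
proof -
  have "finite T"
    using assms(2) finite_subset by blast
  moreover have "inj_on (\<lambda>t. (t + g) mod int n) T"
  proof (rule inj_onI)
    fix s t assume st: "s \<in> T" "t \<in> T" and "(s + g) mod int n = (t + g) mod int n"
    then have "(s + g - g) mod int n = (t + g - g) mod int n"
      by (metis mod_diff_left_eq)
    then show "s = t"
      using st assms(2) by (force simp: subset_iff)
  qed
  ultimately have "(\<lambda>t. (t + g) mod int n) ` T = T"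
    using sub by (simp add: endo_inj_surj image_subset_iff)
  then show ?thesis
    using assms unfolding periodic_set_def
    by (auto simp: carrier_integer_mod_group_pos r_coset_integer_mod_group intro!: bexI[of _ g])
qed

lemma direct_set_sumI:
  assumes "n > 0" "S \<subseteq> {0..<int n}" "S \<noteq> {}" "R \<subseteq> {0..<int n}" "R \<noteq> {}"
    and "\<And>s r s' r'. \<lbrakk>s \<in> S; r \<in> R; s' \<in> S; r' \<in> R; (s + r) mod int n = (s' + r') mod int n\<rbrakk>
          \<Longrightarrow> s = s' \<and> r = r'"
  shows "direct_set_sum (integer_mod_group n) S R"
  unfolding direct_set_sum_def
proof (intro conjI ballI)
  fix x assume "x \<in> S <#>\<^bsub>integer_mod_group n\<^esub> R"
  then obtain s r where sr: "s \<in> S" "r \<in> R" "x = (s + r) mod int n"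
    by (auto simp: set_mult_integer_mod_group)
  show "\<exists>!p. p \<in> S \<times> R \<and> x = fst p \<otimes>\<^bsub>integer_mod_group n\<^esub> snd p"
  proof (rule ex1I[of _ "(s, r)"])
    fix p assume "p \<in> S \<times> R \<and> x = fst p \<otimes>\<^bsub>integer_mod_group n\<^esub> snd p"
    then show "p = (s, r)"
      using sr assms(6)[of "fst p" "snd p" s r]
      by (auto simp: mult_integer_mod_group prod_eq_iff)
  qed (use sr in \<open>simp add: mult_integer_mod_group\<close>)
qed (use assms in \<open>auto simp: carrier_integer_mod_group_pos\<close>)

lemma direct_set_sumD:
  assumes "direct_set_sum (integer_mod_group n) S R"
    and "s \<in> S" "r \<in> R" "s' \<in> S" "r' \<in> R" "(s + r) mod int n = (s' + r') mod int n"
  shows "s = s' \<and> r = r'"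
proof -
  let ?x = "(s + r) mod int n"
  have "?x \<in> S <#>\<^bsub>integer_mod_group n\<^esub> R"
    using assms(2,3) by (auto simp: set_mult_integer_mod_group)
  then have "\<exists>!p. p \<in> S \<times> R \<and> ?x = fst p \<otimes>\<^bsub>integer_mod_group n\<^esub> snd p"
    using assms(1) by (simp add: direct_set_sum_def)
  moreover have "(s, r) \<in> S \<times> R \<and> ?x = fst (s, r) \<otimes>\<^bsub>integer_mod_group n\<^esub> snd (s, r)"
    "(s', r') \<in> S \<times> R \<and> ?x = fst (s', r') \<otimes>\<^bsub>integer_mod_group n\<^esub> snd (s', r')"
    using assms(2-6) by (simp_all add: mult_integer_mod_group)
  ultimately have "(s, r) = (s', r')"
    by blast
  then show ?thesis by simp
qed

text \<open>Each block lies inside \<open>{0..<k * N}\<close>, so no reduction modulo \<open>k * N\<close> takes place in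
  \<open>kS + {0..<k}\<close>.\<close>

lemma set_mult_blocks:
  assumes "k > 0" "N > 0" "S \<subseteq> {0..<int N}"
  shows "((*) (int k) ` S) <#>\<^bsub>integer_mod_group (k * N)\<^esub> {0..<int k}
         = {int k * s + i | s i. s \<in> S \<and> 0 \<le> i \<and> i < int k}"
proof -
  have no_wrap: "(int k * s + i) mod int (k * N) = int k * s + i"
    if "s \<in> S" "0 \<le> i" "i < int k" for s i
    using that assms mod_block[of i "int k" "int N" s] by (auto simp: subset_iff)
  have "((*) (int k) ` S) <#>\<^bsub>integer_mod_group (k * N)\<^esub> {0..<int k}
        = {(int k * s + i) mod int (k * N) | s i. s \<in> S \<and> 0 \<le> i \<and> i < int k}"
    unfolding set_mult_integer_mod_group atLeastLessThan_iff by blast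
  also have "\<dots> = {int k * s + i | s i. s \<in> S \<and> 0 \<le> i \<and> i < int k}"
    by (intro Collect_cong ex_cong1) (metis no_wrap)
  finally show ?thesis .
qed

section \<open>Aperiodicity of the lifted sets\<close>

text \<open>A translation by \<open>g\<close> that maps \<open>kR\<close> into itself preserves the offset \<open>0\<close>, which forces
  \<open>k\<close> to divide \<open>g\<close>; the quotient is then a period of \<open>R\<close>.\<close>

lemma not_periodic_multiples:
  assumes "k > 0" "N > 0" "R \<subseteq> {0..<int N}" "\<not> periodic_set (integer_mod_group N) R"
  shows "\<not> periodic_set (integer_mod_group (k * N)) ((*) (int k) ` R)"
proof
  assume periodic: "periodic_set (integer_mod_group (k * N)) ((*) (int k) ` R)"
  then obtain g where g: "0 < g" "g < int k * int N"
    and per: "\<And>x. x \<in> (*) (int k) ` R \<Longrightarrow> (x + g) mod (int k * int N) \<in> (*) (int k) ` R"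
    by (rule periodic_setE) (use assms(1,2) in simp_all)
  have "R \<noteq> {}"
    using periodic by (simp add: periodic_set_def)
  define h j where "h = g div int k" and "j = g mod int k"
  have g_eq: "g = int k * h + j" and j: "0 \<le> j" "j < int k"
    using assms(1) by (simp_all add: h_def j_def)
  have h: "0 \<le> h" "h < int N"
    using g assms(1) block_number_bounds[of "int k" g "int N"] by (simp_all add: h_def)
  have step: "(r + h) mod int N \<in> R \<and> j = 0" if r: "r \<in> R" for r
  proof -
    obtain r' where r': "r' \<in> R" "(int k * r + g) mod (int k * int N) = int k * r'"
      using per[of "int k * r"] r by blast
    then have "int k * ((r + h) mod int N) + j = int k * r' + 0"
      using mod_block[of j "int k" "int N" "r + h"] j by (simp add: g_eq algebra_simps)
    then show ?thesis
      using block_eq_iff[of j "int k" 0] j assms(1) r'(1) by auto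
  qed
  with \<open>R \<noteq> {}\<close> have "j = 0" by blast
  then have "h \<noteq> 0" using g(1) g_eq by auto
  then have "periodic_set (integer_mod_group N) R"
    using assms h step \<open>R \<noteq> {}\<close> by (intro periodic_set_if_translate_subset[of N R h]) auto
  with assms(4) show False by blast
qed

text \<open>A period of a union of full blocks need not be a multiple of \<open>k\<close> a priori. A single element
  of each block suffices to see the effect on block numbers: the first one if the period moves
  it to another block, and the last one if the period is shorter than a block.\<close>

lemma not_periodic_blocks:
  assumes "k > 0" "N > 1" "S \<subseteq> {0..<int N}" "\<not> periodic_set (integer_mod_group N) S"
  shows "\<not> periodic_set (integer_mod_group (k * N))
           {int k * s + i | s i. s \<in> S \<and> 0 \<le> i \<and> i < int k}"
proof
  let ?B = "{int k * s + i | s i. s \<in> S \<and> 0 \<le> i \<and> i < int k}"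
  assume periodic: "periodic_set (integer_mod_group (k * N)) ?B"
  then obtain g where g: "0 < g" "g < int k * int N"
    and per: "\<And>x. x \<in> ?B \<Longrightarrow> (x + g) mod (int k * int N) \<in> ?B"
    by (rule periodic_setE) (use assms(1,2) in simp_all)
  have "S \<noteq> {}"
    using periodic by (auto simp: periodic_set_def)
  define h j where "h = g div int k" and "j = g mod int k"
  have g_eq: "g = int k * h + j" and j: "0 \<le> j" "j < int k"
    using assms(1) by (simp_all add: h_def j_def)
  have h: "0 \<le> h" "h < int N"
    using g assms(1) block_number_bounds[of "int k" g "int N"] by (simp_all add: h_def)
  have block_mem: "a mod int N \<in> S"
    if l: "(int k * a + l) mod (int k * int N) \<in> ?B" "0 \<le> l" "l < int k" for a l
  proof -
    obtain s i where s: "s \<in> S" "0 \<le> i" "i < int k"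
      "(int k * a + l) mod (int k * int N) = int k * s + i"
      using l(1) by blast
    then have "int k * (a mod int N) + l = int k * s + i"
      using mod_block[of l "int k" "int N" a] l by simp
    then show ?thesis
      using block_eq_iff[of l "int k" i] l s by simp
  qed
  show False
  proof (cases "h = 0")
    case False
    have "(s + h) mod int N \<in> S" if "s \<in> S" for s
    proof -
      \<comment> \<open>The translate of the first element of block \<open>s\<close> has offset \<open>j\<close> in block \<open>s + h\<close>.\<close>
      have "int k * s + 0 \<in> ?B" using that assms(1) by fastforce
      from per[OF this] show ?thesis
        using j by (intro block_mem[of _ j]) (simp_all add: g_eq algebra_simps)
    qed
    then have "periodic_set (integer_mod_group N) S"
      using assms h False \<open>S \<noteq> {}\<close> by (intro periodic_set_if_translate_subset[of N S h]) auto
    with assms(4) show False by blast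
  next
    case True
    then have "j > 0" using g g_eq by simp
    have "(s + 1) mod int N \<in> S" if "s \<in> S" for s
    proof -
      \<comment> \<open>The translate of the last element of block \<open>s\<close> has offset \<open>j - 1\<close> in block \<open>s + 1\<close>.\<close>
      have "int k * s + (int k - 1) \<in> ?B" using that assms(1) by fastforce
      from per[OF this] show ?thesis
        using j \<open>j > 0\<close> True
        by (intro block_mem[of _ "j - 1"]) (simp_all add: g_eq algebra_simps)
    qed
    then have "periodic_set (integer_mod_group N) S"
      using assms \<open>S \<noteq> {}\<close> by (intro periodic_set_if_translate_subset[of N S 1]) auto
    with assms(4) show False by blast
  qed
qed

section \<open>Lifting a Vuza canon\<close>

(* The case N = 1 is excluded: by the literal definition ({0}, {0}) is a Vuza canon of the
   trivial group, but for N = 1 the resulting set S' is all of the group of order k,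
   which is periodic since k > 1. *)
theorem theorem11:
  fixes k N :: nat and S R :: "int set"
  assumes "k > 0" and "N > 0" and "N \<noteq> 1"
    and "vuza_order (k * N)"
    and "vuza_canon (integer_mod_group N) S R"
  shows "direct_set_sum (integer_mod_group (k * N)) ((*) (int k) ` S) {0..<int k} \<and>
    vuza_canon (integer_mod_group (k * N))
      (((*) (int k) ` S) <#>\<^bsub>integer_mod_group (k * N)\<^esub> {0..<int k})
      ((*) (int k) ` R)"
proof -
  let ?G = "integer_mod_group (k * N)"
  let ?B = "{int k * s + i | s i. s \<in> S \<and> 0 \<le> i \<and> i < int k}"
  have kN: "k * N > 0" using assms by simp
  have dir: "direct_set_sum (integer_mod_group N) S R"
    and cover: "{0..<int N} = {(s + r) mod int N | s r. s \<in> S \<and> r \<in> R}"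
    and aper: "\<not> periodic_set (integer_mod_group N) S" "\<not> periodic_set (integer_mod_group N) R"
    using assms(2,5) unfolding vuza_canon_def
    by (simp_all add: carrier_integer_mod_group_pos set_mult_integer_mod_group)
  have S: "S \<subseteq> {0..<int N}" "S \<noteq> {}" and R: "R \<subseteq> {0..<int N}" "R \<noteq> {}"
    using dir assms(2) by (simp_all add: direct_set_sum_def carrier_integer_mod_group_pos)
  have B_eq: "((*) (int k) ` S) <#>\<^bsub>?G\<^esub> {0..<int k} = ?B"
    using assms S by (intro set_mult_blocks)
  have B: "?B \<subseteq> {0..<int (k * N)}" "?B \<noteq> {}"
  proof -
    show "?B \<subseteq> {0..<int (k * N)}"
      using S(1) block_bounds[of _ "int N" _ "int k"] by fastforce
    show "?B \<noteq> {}" using S(2) assms(1) by fastforce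
  qed
  have multiples: "(*) (int k) ` T \<subseteq> {0..<int (k * N)}" if "T \<subseteq> {0..<int N}" for T
    using that assms(1) by auto

  have dir1: "direct_set_sum ?G ((*) (int k) ` S) {0..<int k}"
  proof (rule direct_set_sumI)
    fix x i y j
    assume "x \<in> (*) (int k) ` S" "y \<in> (*) (int k) ` S"
      and ij: "i \<in> {0..<int k}" "j \<in> {0..<int k}"
      and eq: "(x + i) mod int (k * N) = (y + j) mod int (k * N)"
    then obtain s t where st: "s \<in> S" "t \<in> S" "x = int k * s" "y = int k * t" by blast
    have modN: "s mod int N = s" "t mod int N = t" using st S(1) by auto
    have "(x + i) mod int (k * N) = int k * s + i"
      using mod_block[of i "int k" "int N" s] ij by (simp add: st modN)
    moreover have "(y + j) mod int (k * N) = int k * t + j"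
      using mod_block[of j "int k" "int N" t] ij by (simp add: st modN)
    ultimately have "int k * s + i = int k * t + j"
      using eq by argo
    then show "x = y \<and> i = j"
      using block_eq_iff[of i "int k" j s t] ij st by simp
  next
    have "int k * 1 \<le> int k * int N" using assms by (intro mult_left_mono) auto
    then show "{0..<int k} \<subseteq> {0..<int (k * N)}" by auto
  qed (use kN assms S multiples in auto)

  have dir2: "direct_set_sum ?G ?B ((*) (int k) ` R)"
  proof (rule direct_set_sumI)
    fix x u y v
    assume "x \<in> ?B" "y \<in> ?B" "u \<in> (*) (int k) ` R" "v \<in> (*) (int k) ` R"
      and eq: "(x + u) mod int (k * N) = (y + v) mod int (k * N)"
    then obtain s i r t j q where
      mem: "s \<in> S" "t \<in> S" "r \<in> R" "q \<in> R" "0 \<le> i" "i < int k" "0 \<le> j" "j < int k"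
      and xy: "x = int k * s + i" "y = int k * t + j" "u = int k * r" "v = int k * q"
      by blast
    have "(x + u) mod int (k * N) = int k * ((s + r) mod int N) + i"
      using mod_block[of i "int k" "int N" "s + r"] mem by (simp add: xy algebra_simps)
    moreover have "(y + v) mod int (k * N) = int k * ((t + q) mod int N) + j"
      using mod_block[of j "int k" "int N" "t + q"] mem by (simp add: xy algebra_simps)
    ultimately have "int k * ((s + r) mod int N) + i = int k * ((t + q) mod int N) + j"
      using eq by argo
    then have "(s + r) mod int N = (t + q) mod int N" "i = j"
      using block_eq_iff[of i "int k" j] mem by simp_all
    then show "x = y \<and> u = v"
      using direct_set_sumD[OF dir, of s r t q] mem xy by simp
  qed (use kN B R multiples in auto)

  have "x \<in> ?B <#>\<^bsub>?G\<^esub> ((*) (int k) ` R)" if x: "x \<in> {0..<int (k * N)}" for x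
  proof -
    have "x div int k \<in> {0..<int N}"
      using x assms(1) block_number_bounds[of "int k" x "int N"] by simp
    then obtain s r where sr: "s \<in> S" "r \<in> R" "x div int k = (s + r) mod int N"
      unfolding cover by blast
    have i: "0 \<le> x mod int k" "x mod int k < int k" using assms(1) by simp_all
    have "x = int k * ((s + r) mod int N) + x mod int k"
      using sr(3)[symmetric] by simp
    also have "\<dots> = (int k * (s + r) + x mod int k) mod int (k * N)"
      using mod_block[of "x mod int k" "int k" "int N" "s + r"] i by simp
    also have "\<dots> = ((int k * s + x mod int k) + int k * r) mod int (k * N)"
      by (simp add: algebra_simps)
    finally show ?thesis
      unfolding set_mult_integer_mod_group using sr(1,2) i by blast
  qed
  moreover have "?B <#>\<^bsub>?G\<^esub> ((*) (int k) ` R) \<subseteq> {0..<int (k * N)}"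
    using kN unfolding set_mult_integer_mod_group by auto
  ultimately have "carrier ?G = ?B <#>\<^bsub>?G\<^esub> ((*) (int k) ` R)"
    unfolding carrier_integer_mod_group_pos[OF kN] by blast
  then show ?thesis
    unfolding B_eq vuza_canon_def
    using dir1 dir2 not_periodic_blocks[of k N S] not_periodic_multiples[of k N R] assms S R aper
    by auto
qed

end
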